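(* There are absolute constants $c_1,c_2,c_3>0$ such that for every sufficiently large odd prime power $q$ there are a split nondegenerate quadratic form $Q$ on $\mathbb F_q^4$ (i.e. of Witt index two), a nonempty set $P\subseteq\mathbb F_q^4$ and a nonempty family $\mathcal S$ of distinct $Q$-spheres with $$c_1q^{-1}\le\mu(P,\mathcal S)\le c_2q^{-1}\qquad\text{but}\qquad\operatorname{dist}_{\mathrm{lin}}(P,\mathcal S)\ge c_3q^{-1/2}.$$ Consequently the exponent $1/2$ in the bound "$\operatorname{dist}_{\mathrm{lin}}(P,\mathcal S)\le2\sqrt{(d+1)\mu(P,\mathcal S)}$ whenever $\mu(P,\mathcal S)<(d+1)/(d+2)^2$" cannot be improved in general: for no constants $C>0$ and $e>1/2$ does $\operatorname{dist}_{\mathrm{lin}}(P,\mathcal S)\le C\mu(P,\mathcal S)^e$ hold for all such systems.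
   Context: For an odd prime power $q$ and a nondegenerate quadratic form $Q$ on $\mathbb F_q^d$ put $\langle x,y\rangle_Q=\frac{Q(x+y)-Q(x)-Q(y)}2$ and $S_Q(c,r)=\{x\in\mathbb F_q^d:Q(x-c)=r\}$ for $c\in\mathbb F_q^d$, $r\in\mathbb F_q$ (radius zero allowed); spheres are parametrized by pairs $(c,r)$ and distinct spheres means distinct parameter pairs. $I(P,\mathcal S)=|\{(p,S)\in P\times\mathcal S:p\in S\}|$ and $\mu(P,\mathcal S)=1-\frac{I(P,\mathcal S)}{|P||\mathcal S|}$. The lift is $\Phi(S_Q(c,r))=(2c,r-Q(c))\in\mathbb F_q^{d+1}$. For $x\in\mathbb F_q^d$, $y=(u,a)\in\mathbb F_q^d\times\mathbb F_q$ put $\Lambda_x(y)=Q(x)-\langle x,u\rangle_Q-a$. For a (nonempty) affine subspace $L\subseteq\mathbb F_q^{d+1}$ put $\mathcal S(L)=\Phi^{-1}(L)$ and $B(L)=\{x\in\mathbb F_q^d:\Lambda_x(y)=0\ \forall y\in L\}$. Finally $$\operatorname{dist}_{\mathrm{lin}}(P,\mathcal S)=\inf_{L:\,B(L)\ne\varnothing}\left(\frac{|P\setminus B(L)|}{|P|}+\frac{|\mathcal S\setminus\mathcal S(L)|}{|\mathcal S|}\right).$$ *)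

theory Defs
  imports
    "Jordan_Normal_Form.Missing_VectorSpace"
    "HOL-Number_Theory.Prime_Powers"
    Complex_Main
begin

text \<open>
  The order of the field is quantified inside the theorem, so fields are \<open>HOL-Algebra\<close> records
  rather than types; taking them over \<^typ>\<open>int\<close> loses nothing, since every finite field is
  isomorphic to one whose elements are integers. \<open>F\<^sup>d\<close> consists of the functions on \<open>{..<d}\<close>, extended by \<^const>\<open>undefined\<close>.
\<close>

definition coord_space :: "'a ring \<Rightarrow> nat \<Rightarrow> ('a, nat \<Rightarrow> 'a) module" where
  "coord_space F d = ring.func_space F {..<d}"

definition scalar_space :: "'a ring \<Rightarrow> ('a, 'a) module" where
  "scalar_space F = \<lparr>carrier = carrier F, monoid.mult = monoid.mult F, one = \<one>\<^bsub>F\<^esub>,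
     zero = \<zero>\<^bsub>F\<^esub>, add = add F, module.smult = monoid.mult F\<rparr>"

text \<open>\<open>F\<^sup>d\<^sup>+\<^sup>1\<close>, written as \<open>F\<^sup>d \<times> F\<close>.\<close>

definition lift_space :: "'a ring \<Rightarrow> nat \<Rightarrow> ('a, (nat \<Rightarrow> 'a) \<times> 'a) module" where
  "lift_space F d = direct_sum (coord_space F d) (scalar_space F)"


subsection \<open>Quadratic forms\<close>

definition polar :: "'a ring \<Rightarrow> nat \<Rightarrow> ((nat \<Rightarrow> 'a) \<Rightarrow> 'a) \<Rightarrow> (nat \<Rightarrow> 'a) \<Rightarrow> (nat \<Rightarrow> 'a) \<Rightarrow> 'a" where
  "polar F d Q x y = Q (x \<oplus>\<^bsub>coord_space F d\<^esub> y) \<ominus>\<^bsub>F\<^esub> Q x \<ominus>\<^bsub>F\<^esub> Q y"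

text \<open>Linearity of the polar form in one argument suffices, as it is symmetric.\<close>

definition quadratic_form :: "'a ring \<Rightarrow> nat \<Rightarrow> ((nat \<Rightarrow> 'a) \<Rightarrow> 'a) \<Rightarrow> bool" where
  "quadratic_form F d Q \<longleftrightarrow>
     Q \<in> carrier (coord_space F d) \<rightarrow> carrier F \<and>
     (\<forall>a\<in>carrier F. \<forall>x\<in>carrier (coord_space F d).
        Q (a \<odot>\<^bsub>coord_space F d\<^esub> x) = a \<otimes>\<^bsub>F\<^esub> a \<otimes>\<^bsub>F\<^esub> Q x) \<and>
     (\<forall>y\<in>carrier (coord_space F d).
        (\<lambda>x. polar F d Q x y) \<in> LinearCombinations.module_hom F (coord_space F d) (scalar_space F))"

definition bilin :: "'a ring \<Rightarrow> nat \<Rightarrow> ((nat \<Rightarrow> 'a) \<Rightarrow> 'a) \<Rightarrow> (nat \<Rightarrow> 'a) \<Rightarrow> (nat \<Rightarrow> 'a) \<Rightarrow> 'a" where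
  "bilin F d Q x y = polar F d Q x y \<otimes>\<^bsub>F\<^esub> inv\<^bsub>F\<^esub> (\<one>\<^bsub>F\<^esub> \<oplus>\<^bsub>F\<^esub> \<one>\<^bsub>F\<^esub>)"

definition nondegenerate :: "'a ring \<Rightarrow> nat \<Rightarrow> ((nat \<Rightarrow> 'a) \<Rightarrow> 'a) \<Rightarrow> bool" where
  "nondegenerate F d Q \<longleftrightarrow>
     (\<forall>x\<in>carrier (coord_space F d).
        (\<forall>y\<in>carrier (coord_space F d). bilin F d Q x y = \<zero>\<^bsub>F\<^esub>) \<longrightarrow> x = \<zero>\<^bsub>coord_space F d\<^esub>)"

text \<open>The maximal dimension of a subspace on which \<open>Q\<close> vanishes; a maximum over a finite
  nonempty set as \<open>F\<close> is finite.\<close>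

definition witt_index :: "'a ring \<Rightarrow> nat \<Rightarrow> ((nat \<Rightarrow> 'a) \<Rightarrow> 'a) \<Rightarrow> nat" where
  "witt_index F d Q =
     Max {vectorspace.dim F (coord_space F d\<lparr>carrier := W\<rparr>) | W.
            VectorSpace.subspace F W (coord_space F d) \<and> (\<forall>x\<in>W. Q x = \<zero>\<^bsub>F\<^esub>)}"


subsection \<open>Spheres and incidences\<close>

text \<open>A sphere is represented by its parameter pair \<open>(c, r)\<close>, so that a set of pairs is a family of
  distinct spheres even if two of them have the same points.\<close>

definition spheres :: "'a ring \<Rightarrow> nat \<Rightarrow> ((nat \<Rightarrow> 'a) \<times> 'a) set" where
  "spheres F d = carrier (coord_space F d) \<times> carrier F"

definition sphere_points ::
    "'a ring \<Rightarrow> nat \<Rightarrow> ((nat \<Rightarrow> 'a) \<Rightarrow> 'a) \<Rightarrow> (nat \<Rightarrow> 'a) \<times> 'a \<Rightarrow> (nat \<Rightarrow> 'a) set" where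
  "sphere_points F d Q = (\<lambda>(c, r). {x \<in> carrier (coord_space F d). Q (x \<ominus>\<^bsub>coord_space F d\<^esub> c) = r})"

definition incidences ::
    "'a ring \<Rightarrow> nat \<Rightarrow> ((nat \<Rightarrow> 'a) \<Rightarrow> 'a) \<Rightarrow> (nat \<Rightarrow> 'a) set \<Rightarrow> ((nat \<Rightarrow> 'a) \<times> 'a) set \<Rightarrow> nat" where
  "incidences F d Q P S = card {(p, s) \<in> P \<times> S. p \<in> sphere_points F d Q s}"

definition mu ::
    "'a ring \<Rightarrow> nat \<Rightarrow> ((nat \<Rightarrow> 'a) \<Rightarrow> 'a) \<Rightarrow> (nat \<Rightarrow> 'a) set \<Rightarrow> ((nat \<Rightarrow> 'a) \<times> 'a) set \<Rightarrow> real" where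
  "mu F d Q P S = 1 - real (incidences F d Q P S) / (real (card P) * real (card S))"

definition sphere_system ::
    "'a ring \<Rightarrow> nat \<Rightarrow> ((nat \<Rightarrow> 'a) \<Rightarrow> 'a) \<Rightarrow> (nat \<Rightarrow> 'a) set \<Rightarrow> ((nat \<Rightarrow> 'a) \<times> 'a) set \<Rightarrow> bool" where
  "sphere_system F d Q P S \<longleftrightarrow>
     quadratic_form F d Q \<and> nondegenerate F d Q \<and>
     P \<subseteq> carrier (coord_space F d) \<and> P \<noteq> {} \<and> S \<subseteq> spheres F d \<and> S \<noteq> {}"


subsection \<open>The lift and the distance to linear systems\<close>

definition lift :: "'a ring \<Rightarrow> nat \<Rightarrow> ((nat \<Rightarrow> 'a) \<Rightarrow> 'a) \<Rightarrow> (nat \<Rightarrow> 'a) \<times> 'a \<Rightarrow> (nat \<Rightarrow> 'a) \<times> 'a" where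
  "lift F d Q = (\<lambda>(c, r). ((\<one>\<^bsub>F\<^esub> \<oplus>\<^bsub>F\<^esub> \<one>\<^bsub>F\<^esub>) \<odot>\<^bsub>coord_space F d\<^esub> c, r \<ominus>\<^bsub>F\<^esub> Q c))"

definition Lambda ::
    "'a ring \<Rightarrow> nat \<Rightarrow> ((nat \<Rightarrow> 'a) \<Rightarrow> 'a) \<Rightarrow> (nat \<Rightarrow> 'a) \<Rightarrow> (nat \<Rightarrow> 'a) \<times> 'a \<Rightarrow> 'a" where
  "Lambda F d Q x = (\<lambda>(u, a). Q x \<ominus>\<^bsub>F\<^esub> bilin F d Q x u \<ominus>\<^bsub>F\<^esub> a)"

definition affine_subspace :: "'a ring \<Rightarrow> nat \<Rightarrow> ((nat \<Rightarrow> 'a) \<times> 'a) set \<Rightarrow> bool" where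
  "affine_subspace F d L \<longleftrightarrow>
     (\<exists>v\<in>carrier (lift_space F d). \<exists>W. VectorSpace.subspace F W (lift_space F d) \<and>
        L = {v \<oplus>\<^bsub>lift_space F d\<^esub> w | w. w \<in> W})"

definition spheres_of ::
    "'a ring \<Rightarrow> nat \<Rightarrow> ((nat \<Rightarrow> 'a) \<Rightarrow> 'a) \<Rightarrow> ((nat \<Rightarrow> 'a) \<times> 'a) set \<Rightarrow> ((nat \<Rightarrow> 'a) \<times> 'a) set" where
  "spheres_of F d Q L = {s \<in> spheres F d. lift F d Q s \<in> L}"

definition base_locus ::
    "'a ring \<Rightarrow> nat \<Rightarrow> ((nat \<Rightarrow> 'a) \<Rightarrow> 'a) \<Rightarrow> ((nat \<Rightarrow> 'a) \<times> 'a) set \<Rightarrow> (nat \<Rightarrow> 'a) set" where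
  "base_locus F d Q L =
     {x \<in> carrier (coord_space F d). \<forall>y\<in>L. Lambda F d Q x y = \<zero>\<^bsub>F\<^esub>}"

definition dist_lin ::
    "'a ring \<Rightarrow> nat \<Rightarrow> ((nat \<Rightarrow> 'a) \<Rightarrow> 'a) \<Rightarrow> (nat \<Rightarrow> 'a) set \<Rightarrow> ((nat \<Rightarrow> 'a) \<times> 'a) set \<Rightarrow> real" where
  "dist_lin F d Q P S =
     Inf {real (card (P - base_locus F d Q L)) / real (card P) +
          real (card (S - spheres_of F d Q L)) / real (card S) | L.
            affine_subspace F d L \<and> base_locus F d Q L \<noteq> {}}"

end

theory Submission
  imports Defs "HOL-Number_Theory.Residues"
begin

text \<open>
  Take \<open>Q(x) = x\<^sub>0x\<^sub>2 + x\<^sub>1x\<^sub>3\<close>, let \<open>m = \<lfloor>\<surd>q\<rfloor>\<close> and choose \<open>m - 1\<close> scalars \<open>t\<close>.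
  The points \<open>te\<^sub>0\<close> together with \<open>p = e\<^sub>1\<close>, and the radius-zero spheres centred at \<open>te\<^sub>0\<close> together
  with the sphere \<open>s\<close> of radius zero centred at \<open>e\<^sub>3\<close>, have \<open>(p, s)\<close> as their only non-incident pair, so
  \<open>\<mu> = 1/m\<^sup>2\<close>. Every linear system loses \<open>p\<close> or \<open>s\<close>, because \<open>\<Lambda>\<^sub>p(\<Phi>(s)) \<noteq> 0\<close>, hence the distance is
  at least \<open>1/m\<close>. The Witt index is two since some pair of coordinates is injective on any totally
  isotropic subspace.
\<close>

section \<open>Counting the elements of a finite vector space\<close>

lemma (in vectorspace) card_carrier_eq_power_dim:
  assumes K: "finite (carrier K)" and V: "finite (carrier V)"
  shows "card (carrier V) = card (carrier K) ^ dim"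
proof -
  \<comment> \<open>The whole carrier is a finite generating set, so a finite basis can be
    extracted.\<close>
  have "gen_set (carrier V)"
    using in_own_span[of "carrier V"] span_is_subset2[of "carrier V"] by blast
  then have "fin_dim"
    unfolding fin_dim_def using V by blast
  then obtain B where B: "finite B" "basis B"
    using finite_basis_exists by blast
  then have BV: "B \<subseteq> carrier V"
    by (simp add: basis_def)
  have ex1: "\<exists>!a. a \<in> B \<rightarrow>\<^sub>E carrier K \<and> lincomb a B = v" if "v \<in> carrier V" for v
    using basis_criterion[OF B(1) BV, THEN iffD1, OF B(2), THEN spec, THEN mp, OF that] .
  have closed: "lincomb a B \<in> carrier V" if "a \<in> B \<rightarrow>\<^sub>E carrier K" for a
    by (rule lincomb_closed[OF BV]) (use that in \<open>auto simp: PiE_def\<close>)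
  \<comment> \<open>Coordinates with respect to \<open>B\<close>. Coefficient functions are taken
    extensional on \<open>B\<close>, so that each vector has exactly one and they form a finite
    set.\<close>
  have "bij_betw (\<lambda>a. lincomb a B) (B \<rightarrow>\<^sub>E carrier K) (carrier V)"
  proof (rule bij_betwI')
    show "lincomb a B = lincomb b B \<longleftrightarrow> a = b"
      if ab: "a \<in> B \<rightarrow>\<^sub>E carrier K" "b \<in> B \<rightarrow>\<^sub>E carrier K" for a b
    proof
      assume "lincomb a B = lincomb b B"
      with ab the1_equality[OF ex1[OF closed[OF ab(2)]]] show "a = b"
        by (metis (no_types, lifting))
    qed simp
    show "\<exists>a\<in>B \<rightarrow>\<^sub>E carrier K. v = lincomb a B" if "v \<in> carrier V" for v
      using ex1_implies_ex[OF ex1[OF that]] by (elim exE conjE) (rule bexI, simp_all)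
  qed (rule closed)
  then have "card (carrier V) = card (B \<rightarrow>\<^sub>E carrier K)"
    by (simp add: bij_betw_same_card)
  also have "\<dots> = card (carrier K) ^ card B"
    using B(1) by (simp add: card_PiE)
  finally show ?thesis
    using dim_basis[OF B] by simp
qed

lemma (in vectorspace) zero_subspace: "VectorSpace.subspace K {\<zero>\<^bsub>V\<^esub>} V"
  by (auto intro!: VectorSpace.subspace.intro submodule.intro simp: vectorspace_axioms module_axioms)

section \<open>Vectors of length four and the split form\<close>

definition vec4 :: "'a \<Rightarrow> 'a \<Rightarrow> 'a \<Rightarrow> 'a \<Rightarrow> nat \<Rightarrow> 'a" where
  "vec4 a b c d = (\<lambda>i\<in>{..<4}. [a, b, c, d] ! i)"

text \<open>The index one is written \<open>Suc 0\<close>, the form into which the simplifier brings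
  it.\<close>

lemma vec4_nth [simp]:
  "vec4 a b c d 0 = a" "vec4 a b c d (Suc 0) = b" "vec4 a b c d 2 = c" "vec4 a b c d 3 = d"
  by (simp_all add: vec4_def)

lemma lessThan_4: "{..<4::nat} = {0, Suc 0, 2, 3}"
  by auto

lemma vec4_eq_iff [simp]:
  "vec4 a b c d = vec4 a' b' c' d' \<longleftrightarrow> a = a' \<and> b = b' \<and> c = c' \<and> d = d'"
  by (metis vec4_nth)

lemma restrict_4_eq_vec4: "restrict f {..<4} = vec4 (f 0) (f (Suc 0)) (f 2) (f 3)"
  by (rule ext) (auto simp: vec4_def lessThan_4)

text \<open>The orthogonal sum of two hyperbolic planes, on the coordinates 0, 2 and 1, 3.\<close>

definition hyperbolic_form :: "'a ring \<Rightarrow> (nat \<Rightarrow> 'a) \<Rightarrow> 'a" where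
  "hyperbolic_form F x = x 0 \<otimes>\<^bsub>F\<^esub> x 2 \<oplus>\<^bsub>F\<^esub> x (Suc 0) \<otimes>\<^bsub>F\<^esub> x 3"

lemma hyperbolic_form_vec4 [simp]:
  "hyperbolic_form F (vec4 a b c d) = a \<otimes>\<^bsub>F\<^esub> c \<oplus>\<^bsub>F\<^esub> b \<otimes>\<^bsub>F\<^esub> d"
  by (simp add: hyperbolic_form_def)

text \<open>\<open>field\<close> also admits extended records, whereas the notions above take a
  record of type \<open>'a ring\<close>; the locale fixes that type.\<close>

locale plain_field = field F for F :: "'a ring" (structure)
begin

section \<open>The spaces in coordinates\<close>

lemma vectorspace_scalar_space: "vectorspace F (scalar_space F)"
  by (intro vs_criteria) (auto simp: scalar_space_def field_axioms a_ac m_ac l_distr r_distr intro: r_neg)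

lemma vectorspace_coord_space: "vectorspace F (coord_space F d)"
  unfolding coord_space_def vectorspace_def using func_space_is_module field_axioms by blast

lemma vectorspace_lift_space: "vectorspace F (lift_space F d)"
  unfolding lift_space_def
  by (intro direct_sum_is_vs vectorspace_coord_space vectorspace_scalar_space)

lemma coord_space_simps:
  "carrier (coord_space F d) = {..<d} \<rightarrow>\<^sub>E carrier F"
  "\<zero>\<^bsub>coord_space F d\<^esub> = (\<lambda>i\<in>{..<d}. \<zero>)"
  "x \<oplus>\<^bsub>coord_space F d\<^esub> y = (\<lambda>i\<in>{..<d}. x i \<oplus> y i)"
  "a \<odot>\<^bsub>coord_space F d\<^esub> x = (\<lambda>i\<in>{..<d}. a \<otimes> x i)"
  by (simp_all add: coord_space_def func_space_def)

text \<open>The additive inverse is a definite description, not a record field as in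
  \<open>coord_space_simps\<close>, so it can be computed only for members of the carrier.\<close>

lemma coord_space_minus:
  assumes "x \<in> carrier (coord_space F d)" "y \<in> carrier (coord_space F d)"
  shows "x \<ominus>\<^bsub>coord_space F d\<^esub> y = (\<lambda>i\<in>{..<d}. x i \<ominus> y i)"
proof -
  have "\<ominus>\<^bsub>coord_space F d\<^esub> y = (\<lambda>i. if i \<in> {..<d} then \<ominus> y i else undefined)"
    using func_space_neg assms(2) unfolding coord_space_def .
  then show ?thesis
    by (simp add: a_minus_def coord_space_simps cong: restrict_cong)
qed

text \<open>The restriction in \<open>vec4\<close> gives \<open>undefined\<close> off
  \<open>{..<4}\<close>, as extensionality demands, so only the entries are left to check.\<close>

lemma vec4_in_carrier [simp]:
  "vec4 a b c d \<in> carrier (coord_space F 4) \<longleftrightarrow>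
     a \<in> carrier F \<and> b \<in> carrier F \<and> c \<in> carrier F \<and> d \<in> carrier F"
  by (auto simp: coord_space_simps PiE_iff lessThan_4 vec4_def)

text \<open>Splitting into scalars turns the identities for vectors below into polynomial
  identities, which \<open>algebra\<close> decides.\<close>

lemma coord_space_4E:
  assumes "x \<in> carrier (coord_space F 4)"
  obtains a b c d where "a \<in> carrier F" "b \<in> carrier F" "c \<in> carrier F" "d \<in> carrier F"
    "x = vec4 a b c d"
proof -
  from assms have "x = restrict x {..<4}" "\<forall>i<4. x i \<in> carrier F"
    by (auto simp: coord_space_simps)
  then show thesis
    using that[of "x 0" "x (Suc 0)" "x 2" "x 3"] by (simp add: restrict_4_eq_vec4)
qed

lemma vec4_arith:
  "\<zero>\<^bsub>coord_space F 4\<^esub> = vec4 \<zero> \<zero> \<zero> \<zero>"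
  "vec4 a b c d \<oplus>\<^bsub>coord_space F 4\<^esub> vec4 a' b' c' d' = vec4 (a \<oplus> a') (b \<oplus> b') (c \<oplus> c') (d \<oplus> d')"
  "k \<odot>\<^bsub>coord_space F 4\<^esub> vec4 a b c d = vec4 (k \<otimes> a) (k \<otimes> b) (k \<otimes> c) (k \<otimes> d)"
  by (simp_all add: coord_space_simps restrict_4_eq_vec4)

lemma vec4_minus:
  assumes "a \<in> carrier F" "b \<in> carrier F" "c \<in> carrier F" "d \<in> carrier F"
    "a' \<in> carrier F" "b' \<in> carrier F" "c' \<in> carrier F" "d' \<in> carrier F"
  shows "vec4 a b c d \<ominus>\<^bsub>coord_space F 4\<^esub> vec4 a' b' c' d' = 
    vec4 (a \<ominus> a') (b \<ominus> b') (c \<ominus> c') (d \<ominus> d')"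
  using assms by (simp add: coord_space_minus restrict_4_eq_vec4)

section \<open>The form is quadratic and nondegenerate\<close>

lemma polar_hyperbolic_form:
  assumes "a \<in> carrier F" "b \<in> carrier F" "c \<in> carrier F" "d \<in> carrier F"
    "a' \<in> carrier F" "b' \<in> carrier F" "c' \<in> carrier F" "d' \<in> carrier F"
  shows "polar F 4 (hyperbolic_form F) (vec4 a b c d) (vec4 a' b' c' d') =
    a \<otimes> c' \<oplus> a' \<otimes> c \<oplus> b \<otimes> d' \<oplus> b' \<otimes> d"
  using assms unfolding polar_def vec4_arith hyperbolic_form_vec4 by algebra

lemma quadratic_form_hyperbolic: "quadratic_form F 4 (hyperbolic_form F)"
  unfolding quadratic_form_def
proof (intro conjI ballI)
  show "hyperbolic_form F \<in> carrier (coord_space F 4) \<rightarrow> carrier F"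
    by (auto elim!: coord_space_4E)
  fix k x assume "k \<in> carrier F" "x \<in> carrier (coord_space F 4)"
  then show "hyperbolic_form F (k \<odot>\<^bsub>coord_space F 4\<^esub> x) = k \<otimes> k \<otimes> hyperbolic_form F x"
    by (elim coord_space_4E) (simp add: vec4_arith, algebra)
next
  fix y assume y: "y \<in> carrier (coord_space F 4)"
  show "(\<lambda>x. polar F 4 (hyperbolic_form F) x y) \<in> LinearCombinations.module_hom F (coord_space F 4) (scalar_space F)"
    unfolding LinearCombinations.module_hom_def
  proof (intro CollectI conjI allI impI)
    show "(\<lambda>x. polar F 4 (hyperbolic_form F) x y) \<in> carrier (coord_space F 4) \<rightarrow> carrier (scalar_space F)"
      using y by (auto simp: scalar_space_def polar_hyperbolic_form elim!: coord_space_4E)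
    show "polar F 4 (hyperbolic_form F) (x \<oplus>\<^bsub>coord_space F 4\<^esub> x') y =
      polar F 4 (hyperbolic_form F) x y \<oplus>\<^bsub>scalar_space F\<^esub> polar F 4 (hyperbolic_form F) x' y"
      if "x \<in> carrier (coord_space F 4) \<and> x' \<in> carrier (coord_space F 4)" for x x'
      using that y by (elim conjE coord_space_4E)
        (simp add: scalar_space_def vec4_arith polar_hyperbolic_form, algebra)
    show "polar F 4 (hyperbolic_form F) (k \<odot>\<^bsub>coord_space F 4\<^esub> x) y =
      k \<odot>\<^bsub>scalar_space F\<^esub> polar F 4 (hyperbolic_form F) x y"
      if "k \<in> carrier F \<and> x \<in> carrier (coord_space F 4)" for k x
      using that y by (elim conjE coord_space_4E)
        (simp add: scalar_space_def vec4_arith polar_hyperbolic_form, algebra)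
  qed
qed

text \<open>The order of the additive group annihilates \<open>\<one>\<close>. If two also did, an
  odd order would leave \<open>\<one> = \<zero>\<close>.\<close>

lemma two_neq_zero:
  assumes "odd (card (carrier F))"
  shows "\<one> \<oplus> \<one> \<noteq> \<zero>"
proof
  assume two: "\<one> \<oplus> \<one> = \<zero>"
  obtain k where k: "card (carrier F) = 2 * k + 1"
    using assms oddE by blast
  have "add_pow F (card (carrier F)) \<one> = \<zero>"
    using group.pow_order_eq_1[OF a_group, of \<one>] by (simp add: order_def add_pow_def)
  moreover have "add_pow F (2 * k) \<one> = \<zero>"
    using two add.nat_pow_distrib[of \<one> \<one> k] add.nat_pow_mult[of \<one> k k] by (simp flip: mult_2)
  ultimately show False
    by (simp add: k)
qed

lemma nondegenerate_hyperbolic: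
  assumes "\<one> \<oplus> \<one> \<noteq> \<zero>"
  shows "nondegenerate F 4 (hyperbolic_form F)"
  unfolding nondegenerate_def
proof (intro ballI impI)
  fix x assume x: "x \<in> carrier (coord_space F 4)"
    and orth: "\<forall>y\<in>carrier (coord_space F 4). bilin F 4 (hyperbolic_form F) x y = \<zero>"
  obtain a b c d where abcd: "a \<in> carrier F" "b \<in> carrier F" "c \<in> carrier F" "d \<in> carrier F"
    "x = vec4 a b c d"
    using x by (rule coord_space_4E)
  have "(\<one> \<oplus> \<one>) \<otimes> inv (\<one> \<oplus> \<one>) = \<one>"
    using assms by (simp add: field_Units)
  then have inv: "inv (\<one> \<oplus> \<one>) \<in> carrier F" "inv (\<one> \<oplus> \<one>) \<noteq> \<zero>"
    using assms by auto
  have polar0: "polar F 4 (hyperbolic_form F) x y = \<zero>"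
    if "y \<in> carrier (coord_space F 4)" "polar F 4 (hyperbolic_form F) x y \<in> carrier F" for y
    using orth that inv by (auto simp: bilin_def integral_iff)
  \<comment> \<open>Pairing with the four unit vectors in turn reads off the coordinates
    \<open>c\<close>, \<open>d\<close>, \<open>a\<close>, \<open>b\<close>.\<close>
  show "x = \<zero>\<^bsub>coord_space F 4\<^esub>"
    using polar0[of "vec4 \<one> \<zero> \<zero> \<zero>"] polar0[of "vec4 \<zero> \<one> \<zero> \<zero>"]
      polar0[of "vec4 \<zero> \<zero> \<one> \<zero>"] polar0[of "vec4 \<zero> \<zero> \<zero> \<one>"] abcd
    by (simp add: polar_hyperbolic_form vec4_arith)
qed

section \<open>The Witt index is two\<close>

lemma finite_coord_space:
  assumes "finite (carrier F)"
  shows "finite (carrier (coord_space F d))"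
  using assms by (simp add: coord_space_simps finite_PiE)

text \<open>Translates dimensions into cardinalities, so that the Witt index can be found by
  counting.\<close>

lemma card_subspace:
  assumes fin: "finite (carrier F)" and W: "VectorSpace.subspace F W (coord_space F d)"
  shows "card W = card (carrier F) ^ vectorspace.dim F (coord_space F d\<lparr>carrier := W\<rparr>)"
proof -
  interpret V: vectorspace F "coord_space F d"
    by (rule vectorspace_coord_space)
  interpret W: vectorspace F "coord_space F d\<lparr>carrier := W\<rparr>"
    using W by (rule V.subspace_is_vs)
  have "W \<subseteq> carrier (coord_space F d)"
    using W by (simp add: VectorSpace.subspace_def submodule_def)
  then have "finite W"
    using finite_coord_space[OF fin] finite_subset by blast
  then show ?thesis
    using W.card_carrier_eq_power_dim fin by simp
qed

lemma one_less_card: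
  assumes "finite (carrier F)"
  shows "1 < card (carrier F)"
proof -
  have "card {\<zero>, \<one>} \<le> card (carrier F)"
    using assms by (intro card_mono) auto
  then show ?thesis
    by simp
qed

lemma subspace_minus:
  assumes W: "VectorSpace.subspace F W (coord_space F d)" and "x \<in> W" "y \<in> W"
  shows "x \<ominus>\<^bsub>coord_space F d\<^esub> y \<in> W"
proof -
  interpret V: vectorspace F "coord_space F d"
    by (rule vectorspace_coord_space)
  interpret W: submodule F W "coord_space F d"
    using W by (simp add: VectorSpace.subspace_def)
  have "y \<in> carrier (coord_space F d)"
    using W.subset assms by blast
  then have "x \<ominus>\<^bsub>coord_space F d\<^esub> y = x \<oplus>\<^bsub>coord_space F d\<^esub> (\<ominus> \<one>) \<odot>\<^bsub>coord_space F d\<^esub> y"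
    by (simp add: a_minus_def V.smult_minus_1)
  then show ?thesis
    using assms by simp
qed

text \<open>The form vanishes at both vectors and at their sum, which is again in \<open>W\<close>;
  hence so does the polar form, here in coordinates.\<close>

lemma isotropic_polar_zero:
  assumes W: "VectorSpace.subspace F W (coord_space F 4)"
    and iso: "\<forall>x\<in>W. hyperbolic_form F x = \<zero>"
    and "vec4 a b c d \<in> W" "vec4 a' b' c' d' \<in> W"
  shows "a \<otimes> c' \<oplus> a' \<otimes> c \<oplus> b \<otimes> d' \<oplus> b' \<otimes> d = \<zero>"
proof -
  interpret W: submodule F W "coord_space F 4"
    using W by (simp add: VectorSpace.subspace_def)
  have car: "vec4 a b c d \<in> carrier (coord_space F 4)" "vec4 a' b' c' d' \<in> carrier (coord_space F 4)"
    using W.subset assms by auto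
  have "vec4 a b c d \<oplus>\<^bsub>coord_space F 4\<^esub> vec4 a' b' c' d' \<in> W"
    using assms by simp
  \<comment> \<open>\<open>hyperbolic_form_vec4\<close> is withheld to keep the values in the shape
    to which \<open>iso\<close> applies.\<close>
  then have "polar F 4 (hyperbolic_form F) (vec4 a b c d) (vec4 a' b' c' d') = \<zero>"
    unfolding polar_def using iso assms(3,4) by (simp add: a_minus_def del: hyperbolic_form_vec4)
  then show ?thesis
    using car by (simp add: polar_hyperbolic_form)
qed

text \<open>If a coordinate pair is not injective on \<open>W\<close>, some nonzero vector of
  \<open>W\<close> vanishes at both coordinates. The pairs 0, 1 and 2, 3 and 1, 2 and 0, 3 thus give
  one nonzero vector in each of the four totally isotropic coordinate planes, and these vectors
  cannot be pairwise orthogonal.\<close>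

lemma isotropic_inj_on:
  assumes W: "VectorSpace.subspace F W (coord_space F 4)"
    and iso: "\<forall>x\<in>W. hyperbolic_form F x = \<zero>"
  shows "\<exists>i j. i < 4 \<and> j < 4 \<and> inj_on (\<lambda>x. (x i, x j)) W"
proof (rule ccontr)
  assume none: "\<not> ?thesis"
  interpret W: submodule F W "coord_space F 4"
    using W by (simp add: VectorSpace.subspace_def)
  have kernel: "\<exists>a b c d. vec4 a b c d \<in> W \<and> a \<in> carrier F \<and> b \<in> carrier F \<and> c \<in> carrier F \<and> d \<in> carrier F \<and>
    vec4 a b c d i = \<zero> \<and> vec4 a b c d j = \<zero> \<and> vec4 a b c d \<noteq> vec4 \<zero> \<zero> \<zero> \<zero>"
    if ij: "i < 4" "j < 4" for i j
  proof -
    have "\<not> inj_on (\<lambda>x. (x i, x j)) W"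
      using none ij by blast
    then obtain x y where xy: "x \<in> W" "y \<in> W" "x \<noteq> y" "x i = y i" "x j = y j"
      unfolding inj_on_def by auto
    have car: "x \<in> carrier (coord_space F 4)" "y \<in> carrier (coord_space F 4)"
      using xy W.subset by auto
    let ?z = "x \<ominus>\<^bsub>coord_space F 4\<^esub> y"
    interpret V: vectorspace F "coord_space F 4"
      by (rule vectorspace_coord_space)
    have z: "?z \<in> W" "?z \<noteq> \<zero>\<^bsub>coord_space F 4\<^esub>"
      using subspace_minus[OF W] xy car by auto
    have "y i \<in> carrier F" "y j \<in> carrier F"
      using car(2) ij by (auto simp: coord_space_simps)
    then have "?z i = \<zero>" "?z j = \<zero>"
      unfolding coord_space_minus[OF car] using ij xy(4,5) by (simp_all add: a_minus_def r_neg)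
    moreover obtain a b c d where "?z = vec4 a b c d" "a \<in> carrier F" "b \<in> carrier F" "c \<in> carrier F" "d \<in> carrier F"
      by (rule coord_space_4E[OF subsetD[OF W.subset z(1)]])
    ultimately show ?thesis
      using z unfolding vec4_arith by (intro exI[of _ a] exI[of _ b] exI[of _ c] exI[of _ d]) simp
  qed
  obtain c d where 1: "vec4 \<zero> \<zero> c d \<in> W" "c \<noteq> \<zero> \<or> d \<noteq> \<zero>" "c \<in> carrier F" "d \<in> carrier F"
    using kernel[of 0 "Suc 0"] by auto
  obtain a b where 2: "vec4 a b \<zero> \<zero> \<in> W" "a \<noteq> \<zero> \<or> b \<noteq> \<zero>" "a \<in> carrier F" "b \<in> carrier F"
    using kernel[of 2 3] by auto
  obtain a' d' where 3: "vec4 a' \<zero> \<zero> d' \<in> W" "a' \<noteq> \<zero> \<or> d' \<noteq> \<zero>" "a' \<in> carrier F" "d' \<in> carrier F"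
    using kernel[of "Suc 0" 2] by auto
  obtain b' c' where 4: "vec4 \<zero> b' c' \<zero> \<in> W" "b' \<noteq> \<zero> \<or> c' \<noteq> \<zero>" "b' \<in> carrier F" "c' \<in> carrier F"
    using kernel[of 0 3] by auto
  \<comment> \<open>The first two vectors give ac + bd = 0. If c is nonzero, then a' = 0, so d' is
    nonzero, b = 0, a is nonzero, and ac + bd = ac is nonzero. If d is nonzero, then b' = 0, so c'
    is nonzero, a = 0, b is nonzero, and ac + bd = bd is nonzero.\<close>
  show False
    using 1 2 3 4
      isotropic_polar_zero[OF W iso 1(1) 2(1)] isotropic_polar_zero[OF W iso 1(1) 3(1)]
      isotropic_polar_zero[OF W iso 1(1) 4(1)] isotropic_polar_zero[OF W iso 2(1) 3(1)]
      isotropic_polar_zero[OF W iso 2(1) 4(1)] isotropic_polar_zero[OF W iso 3(1) 4(1)]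
    by (auto simp: integral_iff)
qed

lemma card_isotropic_le:
  assumes fin: "finite (carrier F)" and W: "VectorSpace.subspace F W (coord_space F 4)"
    and iso: "\<forall>x\<in>W. hyperbolic_form F x = \<zero>"
  shows "card W \<le> card (carrier F) ^ 2"
proof -
  obtain i j where ij: "i < 4" "j < 4" and inj: "inj_on (\<lambda>x. (x i, x j)) W"
    using isotropic_inj_on[OF W iso] by blast
  have "W \<subseteq> carrier (coord_space F 4)"
    using W by (simp add: VectorSpace.subspace_def submodule_def)
  then have "(\<lambda>x. (x i, x j)) ` W \<subseteq> carrier F \<times> carrier F"
    using ij by (fastforce simp: coord_space_simps)
  then have "card W \<le> card (carrier F \<times> carrier F)"
    using fin by (intro card_inj_on_le[OF inj]) auto
  then show ?thesis
    by (simp add: card_cartesian_product power2_eq_square)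
qed

text \<open>The plane of the first two coordinates attains two, and \<open>card_isotropic_le\<close>
  bounds every other candidate. Both dimensions follow by comparing powers of the field order, which
  exceeds one.\<close>

lemma witt_index_hyperbolic:
  assumes fin: "finite (carrier F)"
  shows "witt_index F 4 (hyperbolic_form F) = 2"
proof -
  let ?iso = "\<lambda>W. VectorSpace.subspace F W (coord_space F 4) \<and> (\<forall>x\<in>W. hyperbolic_form F x = \<zero>)"
  let ?dim = "\<lambda>W. vectorspace.dim F (coord_space F 4\<lparr>carrier := W\<rparr>)"
  let ?W = "{vec4 a b \<zero> \<zero> | a b. a \<in> carrier F \<and> b \<in> carrier F}"
  interpret V: vectorspace F "coord_space F 4"
    by (rule vectorspace_coord_space)
  have "submodule F ?W (coord_space F 4)"
  proof (rule submodule.intro)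
    show "\<zero>\<^bsub>coord_space F 4\<^esub> \<in> ?W"
      unfolding vec4_arith by blast
  qed (auto simp: V.module_axioms vec4_arith)
  then have W: "?iso ?W"
    by (auto intro: VectorSpace.subspace.intro vectorspace_coord_space)
  have "?W = (\<lambda>(a, b). vec4 a b \<zero> \<zero>) ` (carrier F \<times> carrier F)"
    by auto
  also have "card \<dots> = card (carrier F \<times> carrier F)"
    by (rule card_image) (auto simp: inj_on_def)
  finally have "card ?W = card (carrier F) ^ 2"
    by (simp add: card_cartesian_product power2_eq_square)
  then have "card (carrier F) ^ ?dim ?W = card (carrier F) ^ 2"
    unfolding card_subspace[OF fin W[THEN conjunct1], symmetric] .
  then have dim2: "?dim ?W = 2"
    using one_less_card[OF fin] by (simp add: power_inject_exp)
  \<comment> \<open>\<open>Max\<close> is determined only on a finite set; there are finitely many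
    subsets of the space, hence finitely many dimensions.\<close>
  have "{?dim W | W. ?iso W} \<subseteq> ?dim ` Pow (carrier (coord_space F 4))"
    by (auto simp: VectorSpace.subspace_def submodule_def)
  then have "finite {?dim W | W. ?iso W}"
    using finite_coord_space[OF fin] finite_subset by blast
  moreover have "?dim W \<le> 2" if "?iso W" for W
  proof -
    have "card (carrier F) ^ ?dim W \<le> card (carrier F) ^ 2"
      using card_isotropic_le[OF fin] that unfolding card_subspace[OF fin that[THEN conjunct1], symmetric]
      by blast
    then show ?thesis
      by (rule power_le_imp_le_exp[OF one_less_card[OF fin]])
  qed
  ultimately show ?thesis
    unfolding witt_index_def using dim2 W by (intro Max_eqI) auto
qed

section \<open>Systems with a single non-incidence\<close>

lemma mu_single_nonincidence:
  assumes P: "finite P" "p \<in> P" and S: "finite S" "s \<in> S"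
    and inc: "\<And>x t. x \<in> P \<Longrightarrow> t \<in> S \<Longrightarrow> x \<in> sphere_points F d Q t \<longleftrightarrow> (x, t) \<noteq> (p, s)"
  shows "mu F d Q P S = 1 / (real (card P) * real (card S))"
proof -
  have "{(x, t) \<in> P \<times> S. x \<in> sphere_points F d Q t} = P \<times> S - {(p, s)}"
    using inc by auto
  then have "incidences F d Q P S = card P * card S - 1"
    using P S by (simp add: incidences_def card_cartesian_product)
  \<comment> \<open>Nonzero cardinalities make the subtraction of one on natural numbers
    exact.\<close>
  moreover have "card P \<noteq> 0" "card S \<noteq> 0"
    using P S by auto
  ultimately show ?thesis
    by (simp add: mu_def of_nat_diff field_simps Suc_le_eq)
qed

text \<open>Homogeneity with scalar zero gives Q(0) = 0. The lemma serves to exhibit one admissible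
  subspace in the infimum \<open>dist_lin\<close>.\<close>

lemma Lambda_zero:
  assumes two: "\<one> \<oplus> \<one> \<noteq> \<zero>" and Q: "quadratic_form F d Q"
  shows "Lambda F d Q \<zero>\<^bsub>coord_space F d\<^esub> \<zero>\<^bsub>lift_space F d\<^esub> = \<zero>"
proof -
  interpret V: vectorspace F "coord_space F d"
    by (rule vectorspace_coord_space)
  have "Q \<zero>\<^bsub>coord_space F d\<^esub> \<in> carrier F"
    using Q[unfolded quadratic_form_def, THEN conjunct1] by auto
  moreover have "\<forall>a\<in>carrier F. \<forall>x\<in>carrier (coord_space F d).
      Q (a \<odot>\<^bsub>coord_space F d\<^esub> x) = a \<otimes> a \<otimes> Q x"
    by (rule Q[unfolded quadratic_form_def, THEN conjunct2, THEN conjunct1])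
  ultimately have "Q \<zero>\<^bsub>coord_space F d\<^esub> = \<zero>"
    by (metis V.lmult_0 V.M.zero_closed l_null zero_closed)
  moreover have "inv (\<one> \<oplus> \<one>) \<in> carrier F"
    using two by simp
  ultimately show ?thesis
    by (simp add: Lambda_def lift_space_def direct_sum_def scalar_space_def bilin_def polar_def a_minus_def)
qed

text \<open>Whichever of \<open>p\<close> and \<open>s\<close> is lost adds at least one element to
  the numerator of its own quotient; as it is not known which, the minimum appears.\<close>

lemma dist_lin_ge:
  assumes two: "\<one> \<oplus> \<one> \<noteq> \<zero>" and Q: "quadratic_form F d Q"
    and P: "finite P" "p \<in> P" "P \<subseteq> carrier (coord_space F d)" and S: "finite S" "s \<in> S" "S \<subseteq> spheres F d"
    and nonzero: "Lambda F d Q p (lift F d Q s) \<noteq> \<zero>"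
  shows "min (1 / real (card P)) (1 / real (card S)) \<le> dist_lin F d Q P S"
  unfolding dist_lin_def
proof (rule cInf_greatest)
  interpret V: vectorspace F "coord_space F d"
    by (rule vectorspace_coord_space)
  interpret L: vectorspace F "lift_space F d"
    by (rule vectorspace_lift_space)
  \<comment> \<open>\<open>cInf_greatest\<close> asks for a nonempty set of competitors: the origin
    of the lift space is one, its base locus containing the origin.\<close>
  have "affine_subspace F d {\<zero>\<^bsub>lift_space F d\<^esub>}"
    unfolding affine_subspace_def
    using L.zero_subspace
    by (intro bexI[of _ "\<zero>\<^bsub>lift_space F d\<^esub>"] exI[of _ "{\<zero>\<^bsub>lift_space F d\<^esub>}"]) (simp_all del: split_paired_Ex)
  moreover have "\<zero>\<^bsub>coord_space F d\<^esub> \<in> base_locus F d Q {\<zero>\<^bsub>lift_space F d\<^esub>}"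
    by (simp add: base_locus_def Lambda_zero[OF two Q])
  ultimately show "{real (card (P - base_locus F d Q L)) / real (card P) +
          real (card (S - spheres_of F d Q L)) / real (card S) | L.
            affine_subspace F d L \<and> base_locus F d Q L \<noteq> {}} \<noteq> {}"
    by blast
next
  fix \<delta>
  assume "\<delta> \<in> {real (card (P - base_locus F d Q L)) / real (card P) +
          real (card (S - spheres_of F d Q L)) / real (card S) | L.
            affine_subspace F d L \<and> base_locus F d Q L \<noteq> {}}"
  then obtain L where \<delta>: "\<delta> = real (card (P - base_locus F d Q L)) / real (card P) +
          real (card (S - spheres_of F d Q L)) / real (card S)"
    by blast
  have nonneg: "0 \<le> real (card (P - base_locus F d Q L)) / real (card P)"
    "0 \<le> real (card (S - spheres_of F d Q L)) / real (card S)"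
    by simp_all
  have "p \<in> P - base_locus F d Q L \<or> s \<in> S - spheres_of F d Q L"
    using P S nonzero by (auto simp: base_locus_def spheres_of_def)
  then have "1 \<le> card (P - base_locus F d Q L) \<or> 1 \<le> card (S - spheres_of F d Q L)"
    using P(1) S(1) by (auto simp: Suc_le_eq card_gt_0_iff)
  then have "1 / real (card P) \<le> real (card (P - base_locus F d Q L)) / real (card P) \<or>
      1 / real (card S) \<le> real (card (S - spheres_of F d Q L)) / real (card S)"
    by (auto intro!: divide_right_mono)
  then show "min (1 / real (card P)) (1 / real (card S)) \<le> \<delta>"
    using nonneg unfolding \<delta> by linarith
qed

text \<open>The size \<open>m\<close> stays free, so the deficiency is the inverse square of
  \<open>m\<close> while the distance is at least its inverse; only later is \<open>m\<close> tied
  to the field order.\<close>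

lemma near_complete_sphere_system:
  assumes fin: "finite (carrier F)" and two: "\<one> \<oplus> \<one> \<noteq> \<zero>"
    and m: "0 < m" "m \<le> card (carrier F)"
  shows "\<exists>P S. sphere_system F 4 (hyperbolic_form F) P S \<and>
    mu F 4 (hyperbolic_form F) P S = 1 / (real m)\<^sup>2 \<and>
    1 / real m \<le> dist_lin F 4 (hyperbolic_form F) P S"
proof -
  have "m - 1 \<le> card (carrier F)"
    using m by simp
  \<comment> \<open>One element short of \<open>m\<close>, because \<open>p\<close> and
    \<open>s\<close> complete \<open>P\<close> and \<open>S\<close>.\<close>
  then obtain T where T: "T \<subseteq> carrier F" "card T = m - 1"
    by (rule obtain_subset_with_card_n)
  have finT: "finite T"
    using T(1) fin finite_subset by blast
  define p where "p = vec4 \<zero> \<one> \<zero> \<zero>"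
  define s where "s = (vec4 \<zero> \<zero> \<zero> \<one>, \<zero>)"
  define P where "P = insert p ((\<lambda>t. vec4 t \<zero> \<zero> \<zero>) ` T)"
  define S where "S = insert s ((\<lambda>t. (vec4 t \<zero> \<zero> \<zero>, \<zero>)) ` T)"
  have P: "finite P" "p \<in> P" "P \<subseteq> carrier (coord_space F 4)"
    using T(1) finT by (auto simp: P_def p_def)
  have S: "finite S" "s \<in> S" "S \<subseteq> spheres F 4"
    using T(1) finT by (auto simp: S_def s_def spheres_def)
  have "card ((\<lambda>t. vec4 t \<zero> \<zero> \<zero>) ` T) = m - 1"
    using T(2) by (subst card_image) (auto simp: inj_on_def)
  moreover have "p \<notin> (\<lambda>t. vec4 t \<zero> \<zero> \<zero>) ` T"
    by (auto simp: p_def)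
  ultimately have card_P: "card P = m"
    using m(1) finT by (simp add: P_def)
  have "card ((\<lambda>t. (vec4 t \<zero> \<zero> \<zero>, \<zero>)) ` T) = m - 1"
    using T(2) by (subst card_image) (auto simp: inj_on_def)
  moreover have "s \<notin> (\<lambda>t. (vec4 t \<zero> \<zero> \<zero>, \<zero>)) ` T"
    by (auto simp: s_def)
  ultimately have card_S: "card S = m"
    using m(1) finT by (simp add: S_def)
  \<comment> \<open>The difference is (a - c, b, 0, -d), where the form equals -bd. All pairs of
    \<open>P\<close> and \<open>S\<close> are covered: b is one for \<open>p\<close> and zero for
    the other points, and likewise d for \<open>s\<close> and the other centres.\<close>
  have sphere_iff: "vec4 a b \<zero> \<zero> \<in> sphere_points F 4 (hyperbolic_form F) (vec4 c \<zero> \<zero> d, \<zero>) \<longleftrightarrow>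
      b \<otimes> d = \<zero>"
    if "a \<in> carrier F" "b \<in> carrier F" "c \<in> carrier F" "d \<in> carrier F" for a b c d
    using that by (simp add: sphere_points_def vec4_minus) (simp add: a_minus_def r_minus r_neg)
  have inc: "x \<in> sphere_points F 4 (hyperbolic_form F) t \<longleftrightarrow> (x, t) \<noteq> (p, s)"
    if "x \<in> P" "t \<in> S" for x t
    using that T(1) by (auto simp: P_def S_def p_def s_def sphere_iff subset_iff)
  \<comment> \<open>The doubling of the centre in \<open>lift\<close> cancels the half in
    \<open>bilin\<close>: the pairing is one, the remaining terms vanish.\<close>
  have "inv (\<one> \<oplus> \<one>) \<in> carrier F" "(\<one> \<oplus> \<one>) \<otimes> inv (\<one> \<oplus> \<one>) = \<one>"
    using two by (simp_all add: field_Units)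
  then have "Lambda F 4 (hyperbolic_form F) p (lift F 4 (hyperbolic_form F) s) = \<ominus> \<one>"
    by (simp add: Lambda_def lift_def p_def s_def vec4_arith bilin_def polar_hyperbolic_form a_minus_def)
  then have "Lambda F 4 (hyperbolic_form F) p (lift F 4 (hyperbolic_form F) s) \<noteq> \<zero>"
    by simp
  from dist_lin_ge[OF two quadratic_form_hyperbolic P S this]
  have "1 / real m \<le> dist_lin F 4 (hyperbolic_form F) P S"
    by (simp add: card_P card_S)
  moreover have "mu F 4 (hyperbolic_form F) P S = 1 / (real m)\<^sup>2"
    using mu_single_nonincidence[OF P(1,2) S(1,2) inc] by (simp add: card_P card_S power2_eq_square)
  moreover have "sphere_system F 4 (hyperbolic_form F) P S"
    using P S two by (auto simp: sphere_system_def quadratic_form_hyperbolic nondegenerate_hyperbolic)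
  ultimately show ?thesis
    by blast
qed

end

section \<open>Choice of the size, uniform constants and the exponent\<close>

lemma sharp_sphere_system:
  fixes F :: "'a ring"
  assumes "field F" and fin: "finite (carrier F)" and odd: "odd (card (carrier F))"
    and q: "card (carrier F) = q"
  shows "\<exists>Q P S. sphere_system F 4 Q P S \<and> witt_index F 4 Q = 2 \<and>
    1 * real q powr (-1) \<le> mu F 4 Q P S \<and> mu F 4 Q P S \<le> 4 * real q powr (-1) \<and>
    1 * real q powr (-1/2) \<le> dist_lin F 4 Q P S"
proof -
  interpret plain_field F
    using \<open>field F\<close> by (simp add: plain_field_def)
  \<comment> \<open>The square root balances the two quantities: \<open>1 / m\<^sup>2\<close> has
    the order of 1/q, and \<open>1 / m\<close> is at least \<open>q powr (-1/2)\<close>.\<close>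
  define m where "m = nat \<lfloor>sqrt (real q)\<rfloor>"
  have q1: "1 \<le> q"
    using one_less_card[OF fin] q by simp
  then have sqrt1: "1 \<le> sqrt (real q)"
    by simp
  have m_floor: "real m = of_int \<lfloor>sqrt (real q)\<rfloor>"
    unfolding m_def using sqrt1 by simp
  have m1: "1 \<le> real m"
    unfolding m_floor using sqrt1 by simp
  have m_le: "real m \<le> sqrt (real q)" and m_gt: "sqrt (real q) < real m + 1"
    unfolding m_floor by simp_all
  have m_sq: "(real m)\<^sup>2 \<le> real q"
    using power_mono[OF m_le, of 2] by simp
  \<comment> \<open>Rounding down costs at most a factor two, since m + 1 \<le> 2m; its square is
    the constant 4.\<close>
  have "sqrt (real q) \<le> 2 * real m"
    using m1 m_gt by linarith
  then have q_le: "real q \<le> 4 * (real m)\<^sup>2"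
    using power_mono[of "sqrt (real q)" "2 * real m" 2] by (simp add: power_mult_distrib)
  have "m * m \<le> q"
    using m_sq by (simp add: power2_eq_square flip: of_nat_mult)
  then have "m \<le> q"
    using m1 by (metis le_square le_trans)
  then obtain P S where PS: "sphere_system F 4 (hyperbolic_form F) P S"
    "mu F 4 (hyperbolic_form F) P S = 1 / (real m)\<^sup>2"
    "1 / real m \<le> dist_lin F 4 (hyperbolic_form F) P S"
    using near_complete_sphere_system[OF fin two_neq_zero[OF odd], of m] m1 q by auto
  have "real q powr (-1/2) = 1 / sqrt (real q)"
    by (simp add: powr_minus_divide powr_half_sqrt)
  also have "\<dots> \<le> 1 / real m"
    using m1 m_le by (simp add: frac_le)
  finally have dist: "real q powr (-1/2) \<le> dist_lin F 4 (hyperbolic_form F) P S"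
    using PS(3) by simp
  have q_powr: "real q powr (-1) = 1 / real q"
    by (simp add: powr_minus_divide)
  have "1 / real q \<le> 1 / (real m)\<^sup>2"
    using m1 m_sq by (intro frac_le zero_less_power) auto
  moreover have "1 / (real m)\<^sup>2 \<le> 4 / real q"
    using m1 q1 q_le by (simp add: field_simps)
  ultimately show ?thesis
    using PS(1,2) dist witt_index_hyperbolic[OF fin] unfolding q_powr
    by (intro exI[of _ "hyperbolic_form F"] exI[of _ P] exI[of _ S]) simp
qed

text \<open>Residue rings of primes are records over \<open>int\<close>; a prime above N + 2 is odd
  and large enough at once.\<close>

lemma exists_prime_field:
  "\<exists>F :: int ring. field F \<and> finite (carrier F) \<and> N \<le> card (carrier F) \<and> odd (card (carrier F))"
proof -
  obtain p :: nat where p: "prime p" "N + 2 < p"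
    using bigger_prime by blast
  interpret residues_prime p "residue_ring (int p)"
    using p by unfold_locales auto
  show ?thesis
    using p is_field prime_odd_nat[OF p(1)]
    by (intro exI[of _ "residue_ring (int p)"]) (simp add: res_carrier_eq)
qed

text \<open>The quotient of the two sides is a constant times \<open>q powr (1/2 - e)\<close>, which
  tends to zero as the exponent is negative.\<close>

lemma exponent_half_optimal:
  assumes "1 / 2 < (e :: real)"
  shows "eventually (\<lambda>q :: nat. C * (4 * real q powr (-1)) powr e < real q powr (-1/2)) at_top"
proof -
  have "(\<lambda>q :: nat. C * 4 powr e * real q powr (1/2 - e)) \<longlonglongrightarrow> C * 4 powr e * 0"
    using assms by (intro tendsto_intros tendsto_neg_powr filterlim_real_sequentially) auto
  then have "eventually (\<lambda>q :: nat. C * 4 powr e * real q powr (1/2 - e) < 1) at_top"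
    by (intro order_tendstoD(2)[of _ "C * 4 powr e * 0"]) auto
  then show ?thesis
    \<comment> \<open>For q = 0 the factor \<open>q powr (-1/2)\<close> would be zero and the strict
      inequality would be lost.\<close>
    using eventually_gt_at_top[of 0]
  proof eventually_elim
    case (elim q)
    have "(4 * real q powr (-1)) powr e = 4 powr e * real q powr (-e)"
      using elim by (simp add: powr_divide powr_minus_divide)
    then have "C * (4 * real q powr (-1)) powr e = C * 4 powr e * real q powr (1/2 - e) * real q powr (-1/2)"
      by (simp flip: powr_add)
    also have "\<dots> < 1 * real q powr (-1/2)"
      using elim by (intro mult_strict_right_mono) auto
    finally show ?case
      by simp
  qed
qed

text \<open>The refuted inequality is demanded only in dimension four, at Witt index two and for
  deficiency below 5/36, so the bound fails even in this range. The systems of the first half, over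
  a large prime field, refute it.\<close>

theorem proposition2p11:
  shows
    "(\<exists>c1 c2 c3 :: real. c1 > 0 \<and> c2 > 0 \<and> c3 > 0 \<and>
       (\<exists>q0 :: nat. \<forall>q \<ge> q0. primepow q \<and> odd q \<longrightarrow>
          (\<forall>F :: int ring. field F \<and> finite (carrier F) \<and> card (carrier F) = q \<longrightarrow>
             (\<exists>Q P S. sphere_system F 4 Q P S \<and> witt_index F 4 Q = 2 \<and>
                c1 * real q powr (-1) \<le> mu F 4 Q P S \<and>
                mu F 4 Q P S \<le> c2 * real q powr (-1) \<and>
                dist_lin F 4 Q P S \<ge> c3 * real q powr (-1/2)))))
     \<and>
     \<not> (\<exists>C e :: real. C > 0 \<and> e > 1/2 \<and>
          (\<forall>F :: int ring. \<forall>Q P S.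
             field F \<and> finite (carrier F) \<and> odd (card (carrier F)) \<and>
             sphere_system F 4 Q P S \<and> witt_index F 4 Q = 2 \<and>
             mu F 4 Q P S < (4 + 1) / (4 + 2)\<^sup>2 \<longrightarrow>
             dist_lin F 4 Q P S \<le> C * mu F 4 Q P S powr e))"
proof (intro conjI notI)
  show "\<exists>c1 c2 c3 :: real. c1 > 0 \<and> c2 > 0 \<and> c3 > 0 \<and>
       (\<exists>q0 :: nat. \<forall>q \<ge> q0. primepow q \<and> odd q \<longrightarrow>
          (\<forall>F :: int ring. field F \<and> finite (carrier F) \<and> card (carrier F) = q \<longrightarrow>
             (\<exists>Q P S. sphere_system F 4 Q P S \<and> witt_index F 4 Q = 2 \<and>
                c1 * real q powr (-1) \<le> mu F 4 Q P S \<and>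
                mu F 4 Q P S \<le> c2 * real q powr (-1) \<and>
                dist_lin F 4 Q P S \<ge> c3 * real q powr (-1/2))))"
    \<comment> \<open>The constants are 1, 4 and 1; \<open>sharp_sphere_system\<close> spells out
      its factors \<open>1 *\<close> so that it unifies with this goal.\<close>
    by (intro exI[of _ 1] exI[of _ 4] exI[of _ 0] conjI allI impI sharp_sphere_system) auto
next
  assume "\<exists>C e :: real. C > 0 \<and> e > 1/2 \<and>
          (\<forall>F :: int ring. \<forall>Q P S.
             field F \<and> finite (carrier F) \<and> odd (card (carrier F)) \<and>
             sphere_system F 4 Q P S \<and> witt_index F 4 Q = 2 \<and>
             mu F 4 Q P S < (4 + 1) / (4 + 2)\<^sup>2 \<longrightarrow>
             dist_lin F 4 Q P S \<le> C * mu F 4 Q P S powr e)"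
  then obtain C e :: real where Ce: "C > 0" "e > 1/2"
    and bound: "\<And>(F :: int ring) Q P S. field F \<Longrightarrow> finite (carrier F) \<Longrightarrow> odd (card (carrier F)) \<Longrightarrow>
      sphere_system F 4 Q P S \<Longrightarrow> witt_index F 4 Q = 2 \<Longrightarrow> mu F 4 Q P S < (4 + 1) / (4 + 2)\<^sup>2 \<Longrightarrow>
      dist_lin F 4 Q P S \<le> C * mu F 4 Q P S powr e"
    by blast
  obtain N where N: "\<And>q. N \<le> q \<Longrightarrow> C * (4 * real q powr (-1)) powr e < real q powr (-1/2)"
    using exponent_half_optimal[OF Ce(2), of C] unfolding eventually_at_top_linorder by blast
  \<comment> \<open>4/q < 5/36 means q > 28.8, whence the 29.\<close>
  obtain F :: "int ring" where F: "field F" "finite (carrier F)" "odd (card (carrier F))"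
    and large: "max N 29 \<le> card (carrier F)"
    using exists_prime_field by blast
  define q where "q = card (carrier F)"
  obtain Q P S where QPS: "sphere_system F 4 Q P S" "witt_index F 4 Q = 2"
    and mu: "1 * real q powr (-1) \<le> mu F 4 Q P S" "mu F 4 Q P S \<le> 4 * real q powr (-1)"
    and dist: "1 * real q powr (-1/2) \<le> dist_lin F 4 Q P S"
    using sharp_sphere_system[OF F q_def[symmetric]] by blast
  have "4 * real q powr (-1) < (4 + 1) / (4 + 2)\<^sup>2"
    using large by (simp add: q_def powr_minus_divide field_simps)
  then have "dist_lin F 4 Q P S \<le> C * mu F 4 Q P S powr e"
    using mu(2) by (intro bound F QPS) linarith
  \<comment> \<open>The lower bound on the deficiency supplies the nonnegativity that monotonicity
    of powers requires.\<close>
  also have "\<dots> \<le> C * (4 * real q powr (-1)) powr e"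
    using Ce mu by (intro mult_left_mono powr_mono2) (auto intro: order_trans[OF powr_ge_zero])
  also have "\<dots> < real q powr (-1/2)"
    using large by (intro N) (simp add: q_def)
  finally show False
    using dist by simp
qed

end
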